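(* Let $m, k > 1$ be integers, let $y$ be a positive integer with $y < k$, and let $c = \gcd(y,k)$. Consider a deck of $m^k$ cards, and let $\langle I_{m^y}, O_{m^y}\rangle$ be the subgroup of the symmetric group on the $m^k$ card positions generated by the in $m^y$-shuffle $I_{m^y}$ and the out $m^y$-shuffle $O_{m^y}$. (1) If $y/c$ is odd, then $\langle I_{m^y}, O_{m^y}\rangle$ is isomorphic to $(\mathbb{Z}_2)^{k/c} \rtimes_\phi \mathbb{Z}_{k/c}$, where $\mathbb{Z}_{k/c}$ acts on $(\mathbb{Z}_2)^{k/c}$ by a cyclic shift, that is, $$\phi(1)\cdot(a_1, a_2, \ldots, a_{k/c}) = (a_{k/c}, a_1, a_2, \ldots, a_{\frac{k}{c}-1}).$$ (2) If $y/c$ is even, then $\langle I_{m^y}, O_{m^y}\rangle$ is isomorphic to $(\mathbb{Z}_2)^{\frac{k}{c}-1} \rtimes_\phi \mathbb{Z}_{k/c}$, where $\mathbb{Z}_{k/c}$ acts on $(\mathbb{Z}_2)^{\frac{k}{c}-1}$ by $$\phi(1)\cdot(a_1, a_2, \ldots, a_{\frac{k}{c}-1}) = (a_{\frac{k}{c}-1},\ a_1 + a_{\frac{k}{c}-1},\ a_2 + a_{\frac{k}{c}-1},\ \ldots,\ a_{\frac{k}{c}-2} + a_{\frac{k}{c}-1}).$$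
   Context: $\mathbb{Z}_n$ denotes the cyclic group of integers modulo $n$. Generalized perfect shuffles: for a deck of $Mn$ cards, index each card position by its distance from the top of the deck, from $0$ to $Mn-1$. Divide the deck into $M$ stacks of $n$ consecutive cards (the first stack is the first $n$ cards, the second stack the next $n$ cards, and so on), placed side by side in order from left to right. The out $M$-shuffle $O_M$ reassembles the deck by repeatedly picking up the top cards of the $M$ stacks from left to right, so the original top card stays on top. The in $M$-shuffle $I_M$ does the same but picks up from right to left, so the original top card becomes the $M$-th card. Explicitly, for $i = an + b$ with $0 \le a < M$ and $0 \le b < n$, the card at position $i$ is moved $$O_M:\ i \mapsto bM + a, \qquad I_M:\ i \mapsto bM + (M-1-a).$$ Both are permutations of $\{0, 1, \ldots, Mn-1\}$. Here $M = m^y$ and $n = m^{k-y}$. *)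

theory Defs
  imports "HOL-Algebra.Algebra"
begin

text \<open>
  Writing a position as \<open>i = a * n + b\<close> with \<open>a < M\<close> and \<open>b < n\<close>, we have \<open>a = i div n\<close> and
  \<open>b = i mod n\<close>. The functions are restricted to the deck so that they are elements of
  the symmetric group \<^const>\<open>BijGroup\<close> on the set of positions.
\<close>

definition out_shuffle :: "nat \<Rightarrow> nat \<Rightarrow> nat \<Rightarrow> nat"
  where "out_shuffle M n = (\<lambda>i\<in>{..<M * n}. (i mod n) * M + i div n)"

definition in_shuffle :: "nat \<Rightarrow> nat \<Rightarrow> nat \<Rightarrow> nat"
  where "in_shuffle M n = (\<lambda>i\<in>{..<M * n}. (i mod n) * M + (M - 1 - i div n))"

lemma bij_betw_finite_endoI:
  assumes "finite A" "inj_on f A" "f ` A \<subseteq> A"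
  shows "bij_betw f A A"
  using assms by (simp add: bij_betw_def endo_inj_surj)

lemma digits_less:
  fixes a b M n :: nat
  assumes "a < M" "b < n"
  shows "b * M + a < M * n"
proof -
  have "b * M + a < Suc b * M" using assms by simp
  also have "\<dots> \<le> n * M" using assms by (intro mult_right_mono) auto
  finally show ?thesis by (simp add: mult.commute)
qed

lemma digits_unique:
  fixes a b M :: nat
  assumes "b * M + a = b' * M + a'" "a < M" "a' < M"
  shows "b = b'" "a = a'"
proof -
  have "(b * M + a) div M = b" "(b' * M + a') div M = b'"
    using assms(2,3) by (simp_all add: div_mult_self3)
  then show "b = b'" using assms(1) by metis
  then show "a = a'" using assms(1) by simp
qed

lemma stack_less: "i < M * n \<Longrightarrow> i div n < M" for i M n :: nat
  by (simp add: less_mult_imp_div_less)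

lemma height_less: "i < M * n \<Longrightarrow> i mod n < n" for i M n :: nat
  by (cases n) auto

lemma out_shuffle_in_BijGroup: "out_shuffle M n \<in> carrier (BijGroup {..<M * n})"
proof -
  have "inj_on (out_shuffle M n) {..<M * n}"
  proof (rule inj_onI)
    fix i j assume i: "i \<in> {..<M * n}" and j: "j \<in> {..<M * n}"
      and eq: "out_shuffle M n i = out_shuffle M n j"
    have "i mod n * M + i div n = j mod n * M + j div n"
      using i j eq by (simp add: out_shuffle_def)
    from digits_unique[OF this] i j have "i mod n = j mod n" "i div n = j div n"
      by (auto simp: stack_less)
    then show "i = j" by (metis div_mult_mod_eq)
  qed
  moreover have "out_shuffle M n ` {..<M * n} \<subseteq> {..<M * n}"
    by (auto simp: out_shuffle_def intro!: digits_less stack_less height_less)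
  ultimately have "bij_betw (out_shuffle M n) {..<M * n} {..<M * n}"
    by (intro bij_betw_finite_endoI) auto
  then show ?thesis by (simp add: BijGroup_def Bij_def out_shuffle_def)
qed

lemma in_shuffle_in_BijGroup: "in_shuffle M n \<in> carrier (BijGroup {..<M * n})"
proof -
  have less: "M - 1 - i div n < M" if "i < M * n" for i
    using stack_less[OF that] by simp
  have "inj_on (in_shuffle M n) {..<M * n}"
  proof (rule inj_onI)
    fix i j assume i: "i \<in> {..<M * n}" and j: "j \<in> {..<M * n}"
      and eq: "in_shuffle M n i = in_shuffle M n j"
    have "i mod n * M + (M - 1 - i div n) = j mod n * M + (M - 1 - j div n)"
      using i j eq by (simp add: in_shuffle_def)
    from digits_unique[OF this less less] i j
    have "i mod n = j mod n" "M - 1 - i div n = M - 1 - j div n" by blast+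
    moreover have "i div n < M" "j div n < M" using i j by (auto simp: stack_less)
    ultimately have "i mod n = j mod n" "i div n = j div n" by linarith+
    then show "i = j" by (metis div_mult_mod_eq)
  qed
  moreover have "in_shuffle M n ` {..<M * n} \<subseteq> {..<M * n}"
  proof (rule image_subsetI)
    fix i assume "i \<in> {..<M * n}"
    then show "in_shuffle M n i \<in> {..<M * n}"
      using digits_less[where a = "M - 1 - i div n" and b = "i mod n" and M = M and n = n, OF less height_less[of i M n]] by (simp add: in_shuffle_def)
  qed
  ultimately have "bij_betw (in_shuffle M n) {..<M * n} {..<M * n}"
    by (intro bij_betw_finite_endoI) auto
  then show ?thesis by (simp add: BijGroup_def Bij_def in_shuffle_def)
qed

definition semidirect_product ::
    "('a, 'c) monoid_scheme \<Rightarrow> ('b, 'd) monoid_scheme \<Rightarrow> ('b \<Rightarrow> 'a \<Rightarrow> 'a) \<Rightarrow> ('a \<times> 'b) monoid"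
  where "semidirect_product N H \<phi> =
    \<lparr>carrier = carrier N \<times> carrier H,
     monoid.mult = (\<lambda>(a, g) (b, h). (a \<otimes>\<^bsub>N\<^esub> \<phi> g b, g \<otimes>\<^bsub>H\<^esub> h)),
     one = (\<one>\<^bsub>N\<^esub>, \<one>\<^bsub>H\<^esub>)\<rparr>"

lemma group_semidirect_product:
  assumes N: "group N" and H: "group H" and \<phi>: "\<phi> \<in> hom H (AutoGroup N)"
  shows "group (semidirect_product N H \<phi>)"
proof -
  interpret N: group N by fact
  interpret H: group H by fact
  have A: "group (AutoGroup N)" by (rule N.AutoGroup)
  have car: "\<phi> g \<in> auto N" if "g \<in> carrier H" for g
    using \<phi> that by (auto simp: hom_def AutoGroup_def)
  have hom: "\<phi> g \<in> hom N N" if "g \<in> carrier H" for g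
    using car[OF that] by (simp add: auto_def)
  have closed: "\<phi> g a \<in> carrier N" if "g \<in> carrier H" "a \<in> carrier N" for g a
    using hom[OF that(1)] that(2) by (auto simp: hom_def)
  have mult: "\<phi> g (a \<otimes>\<^bsub>N\<^esub> b) = \<phi> g a \<otimes>\<^bsub>N\<^esub> \<phi> g b"
    if "g \<in> carrier H" "a \<in> carrier N" "b \<in> carrier N" for g a b
    using hom[OF that(1)] that(2,3) by (auto simp: hom_def)
  have comp: "\<phi> (g \<otimes>\<^bsub>H\<^esub> h) a = \<phi> g (\<phi> h a)"
    if "g \<in> carrier H" "h \<in> carrier H" "a \<in> carrier N" for g h a
  proof -
    have "\<phi> (g \<otimes>\<^bsub>H\<^esub> h) = \<phi> g \<otimes>\<^bsub>AutoGroup N\<^esub> \<phi> h"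
      using \<phi> that by (simp add: hom_def)
    then show ?thesis
      using car[OF that(1)] car[OF that(2)] that(3)
      by (simp add: AutoGroup_def BijGroup_def auto_def compose_def)
  qed
  have one: "\<phi> \<one>\<^bsub>H\<^esub> a = a" if "a \<in> carrier N" for a
    using hom_one[OF \<phi> H A] that by (simp add: AutoGroup_def BijGroup_def)
  show ?thesis
  proof (rule groupI)
    fix x assume x: "x \<in> carrier (semidirect_product N H \<phi>)"
    then obtain a g where ag: "x = (a, g)" "a \<in> carrier N" "g \<in> carrier H"
      by (auto simp: semidirect_product_def)
    let ?y = "(\<phi> (inv\<^bsub>H\<^esub> g) (inv\<^bsub>N\<^esub> a), inv\<^bsub>H\<^esub> g)"
    have "\<phi> (inv\<^bsub>H\<^esub> g) (inv\<^bsub>N\<^esub> a) \<otimes>\<^bsub>N\<^esub> \<phi> (inv\<^bsub>H\<^esub> g) a = \<phi> (inv\<^bsub>H\<^esub> g) \<one>\<^bsub>N\<^esub>"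
      using ag by (simp flip: mult)
    also have "\<dots> = \<one>\<^bsub>N\<^esub>" using hom_one[OF hom[of "inv\<^bsub>H\<^esub> g"] N N] ag by simp
    finally show "\<exists>y\<in>carrier (semidirect_product N H \<phi>).
        y \<otimes>\<^bsub>semidirect_product N H \<phi>\<^esub> x = \<one>\<^bsub>semidirect_product N H \<phi>\<^esub>"
      using ag closed by (intro bexI[of _ ?y]) (auto simp: semidirect_product_def)
  qed (auto simp: semidirect_product_def closed mult comp one N.m_assoc H.m_assoc)
qed

abbreviation Z2_power :: "nat \<Rightarrow> (nat \<Rightarrow> int) monoid"
  where "Z2_power r \<equiv> product_group {1..r} (\<lambda>_. integer_mod_group 2)"

definition cyclic_shift :: "nat \<Rightarrow> (nat \<Rightarrow> int) \<Rightarrow> nat \<Rightarrow> int"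
  where "cyclic_shift r = (\<lambda>a\<in>carrier (Z2_power r). \<lambda>i\<in>{1..r}. if i = 1 then a r else a (i - 1))"

definition twisted_shift :: "nat \<Rightarrow> (nat \<Rightarrow> int) \<Rightarrow> nat \<Rightarrow> int"
  where "twisted_shift r = (\<lambda>a\<in>carrier (Z2_power r). \<lambda>i\<in>{1..r}.
    if i = 1 then a r else a (i - 1) \<otimes>\<^bsub>integer_mod_group 2\<^esub> a r)"

text \<open>
  As \<open>1\<close> generates the cyclic group of integers modulo \<open>q\<close>, there is at most one action \<open>\<phi>\<close>
  (up to its values outside the carrier) in which \<open>1\<close> acts as a given automorphism \<open>\<sigma>\<close>.
\<close>

definition cyclic_action :: "nat \<Rightarrow> ('a, 'b) monoid_scheme \<Rightarrow> ('a \<Rightarrow> 'a) \<Rightarrow> (int \<Rightarrow> 'a \<Rightarrow> 'a) \<Rightarrow> bool"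
  where "cyclic_action q N \<sigma> \<phi> \<longleftrightarrow> \<phi> \<in> hom (integer_mod_group q) (AutoGroup N) \<and> \<phi> 1 = \<sigma>"

end

theory Submission
  imports Defs
begin

text \<open>
  Put \<open>c = gcd y k\<close>, \<open>b = m\<^sup>c\<close>, \<open>q = k / c\<close> and \<open>s = y / c\<close>, and write a position with \<open>q\<close> digits in base \<open>b\<close>.
  The out shuffle rotates the digits by \<open>s\<close> places, and the in shuffle also replaces the \<open>s\<close> lowest
  digits \<open>d\<close> by \<open>b - 1 - d\<close>. As \<open>s\<close> is coprime to \<open>q\<close>, the shuffles generate all rotations, together
  with the complementations in the cyclic submodule of \<open>\<int>\<^sub>2[x]/(x\<^sup>q - 1)\<close> generated by
  \<open>v = 1 + x + \<dots> + x\<^bsup>s-1\<^esup>\<close>. This submodule contains \<open>(x - 1)v = x\<^sup>s - 1\<close>, hence \<open>x - 1\<close>, hence all vectors of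
  even weight. It is everything if \<open>s\<close> is odd, and the vectors of even weight if \<open>s\<close> is even.
\<close>

section \<open>Digits in a fixed base\<close>

definition digit :: "nat \<Rightarrow> nat \<Rightarrow> nat \<Rightarrow> nat"
  where "digit b x j = x div b ^ j mod b"

lemma digit_less: "0 < b \<Longrightarrow> digit b x j < b"
  by (simp add: digit_def)

text \<open>\<open>x * b ^ p + y\<close> is the digit word of \<open>x\<close> placed above the
  \<open>p\<close> lowest digits, which are those of \<open>y\<close>.\<close>

lemma digit_append:
  assumes "y < b ^ p"
  shows "digit b (x * b ^ p + y) j = (if j < p then digit b y j else digit b x (j - p))"
proof (cases "j < p")
  case True
  then obtain d where "p = j + Suc d" by (metis add_Suc_right less_imp_Suc_add)
  then have "x * b ^ p + y = y + (x * b ^ d * b) * b ^ j"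
    by (simp add: power_add mult_ac)
  moreover have "b ^ j \<noteq> 0" using assms \<open>p = j + Suc d\<close> by (cases "b = 0") auto
  ultimately have "(x * b ^ p + y) div b ^ j = x * b ^ d * b + y div b ^ j"
    by (metis div_mult_self1 add.commute)
  then show ?thesis using True by (simp add: digit_def)
next
  case False
  then have "(x * b ^ p + y) div b ^ j = (x * b ^ p + y) div b ^ p div b ^ (j - p)"
    by (simp flip: div_mult2_eq power_add)
  also have "(x * b ^ p + y) div b ^ p = x" using assms
    by (metis add.right_neutral div_less div_mult_self3 not_less_zero)
  finally show ?thesis using False by (simp add: digit_def)
qed

lemma digit_mod:
  assumes "0 < b" "j < p"
  shows "digit b (x mod b ^ p) j = digit b x j"
  using digit_append[of "x mod b ^ p" b p "x div b ^ p" j] assms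
  by (simp del: div_mult_mod_eq) (simp only: div_mult_mod_eq)

lemma digit_div: "digit b (x div b ^ p) j = digit b x (j + p)"
  by (simp add: digit_def power_add mult.commute flip: div_mult2_eq)

text \<open>Subtracting from the word with all digits \<open>b - 1\<close> never borrows, so it acts
  on each digit separately.\<close>

lemma digit_complement:
  assumes "0 < b" "x < b ^ p" "j < p"
  shows "digit b (b ^ p - 1 - x) j = b - 1 - digit b x j"
proof -
  \<comment> \<open>The same for two mixed-radix places. It is applied with \<open>M = b ^ j\<close>
    to drop the low digits, then with \<open>M = b\<close> to read the next one.\<close>
  have step: "(M * N - 1 - a) div M = N - 1 - a div M \<and> (M * N - 1 - a) mod M = M - 1 - a mod M"
    if "a < M * N" for a M N :: nat
  proof -
    have M: "0 < M" using that by (cases M) auto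
    have "a div M < N" using that M by (simp add: less_mult_imp_div_less mult.commute)
    \<comment> \<open>\<open>e\<close> and \<open>f\<close> are the complements of quotient and
      remainder, introduced additively to avoid truncated subtraction.\<close>
    then obtain e where e: "N = a div M + Suc e" by (metis add_Suc_right less_imp_Suc_add)
    obtain f where f: "M = a mod M + Suc f" using M
      by (metis add_Suc_right less_imp_Suc_add mod_less_divisor)
    have "M * N = M * (a div M) + M + e * M" by (subst e) (simp add: algebra_simps)
    also have "\<dots> = M * (a div M) + (a mod M + Suc f) + e * M" using f by simp
    also have "\<dots> = a + 1 + (f + e * M)" using mult_div_mod_eq[of M a] by linarith
    finally have "M * N - 1 - a = e * M + f" by simp
    moreover have "f < M" using f by linarith
    ultimately have "(M * N - 1 - a) div M = e" "(M * N - 1 - a) mod M = f"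
      by (simp_all add: div_mult_self3 add.commute)
    then show ?thesis using e f by (simp only:) linarith
  qed
  obtain d where d: "p = j + Suc d" using assms(3) by (metis add_Suc_right less_imp_Suc_add)
  have "x < b ^ j * (b * b ^ d)" using assms(2) d by (simp add: power_add mult_ac)
  then have 1: "(b ^ j * (b * b ^ d) - 1 - x) div b ^ j = b * b ^ d - 1 - x div b ^ j"
    using step by blast
  have pow: "b ^ p = b ^ j * (b * b ^ d)" using d by (simp add: power_add)
  have "x div b ^ j < b * b ^ d"
    using \<open>x < b ^ j * (b * b ^ d)\<close> by (simp add: less_mult_imp_div_less mult.commute)
  then show ?thesis using step[of "x div b ^ j" b "b ^ d"] 1 by (simp add: digit_def pow)
qed

lemma digits_eqI:
  assumes "x < b ^ q" "y < b ^ q" "\<And>j. j < q \<Longrightarrow> digit b x j = digit b y j"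
  shows "x = y"
  using assms
proof (induction q arbitrary: x y)
  case (Suc q)
  have b: "0 < b" using Suc.prems(1) by (cases b) auto
  have "x mod b ^ q = y mod b ^ q"
    by (rule Suc.IH) (simp_all add: b Suc.prems(3) digit_mod)
  moreover have "x div b ^ q < b" "y div b ^ q < b"
    using Suc.prems(1,2) by (simp_all add: less_mult_imp_div_less)
  then have "x div b ^ q = y div b ^ q"
    using Suc.prems(3)[of q] by (simp add: digit_def)
  ultimately show ?case by (metis div_mult_mod_eq)
qed simp

lemma digits_exist:
  assumes "\<And>j. j < q \<Longrightarrow> f j < b"
  shows "\<exists>x<b ^ q. \<forall>j<q. digit b x j = f j"
  using assms
proof (induction q)
  case (Suc q)
  then obtain x where x: "x < b ^ q" "\<forall>j<q. digit b x j = f j" by auto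
  have "f q < b" using Suc.prems by simp
  then have "f q * b ^ q + x < b ^ q * b" using x(1) digits_less[of x "b ^ q" "f q" b] by simp
  moreover have "digit b (f q * b ^ q + x) j = f j" if "j < Suc q" for j
    using that x \<open>f q < b\<close> by (auto simp: digit_append less_Suc_eq) (simp add: digit_def)
  ultimately show ?case by (intro exI[of _ "f q * b ^ q + x"]) (simp add: mult.commute)
qed simp

section \<open>Rotating and complementing digits\<close>

definition complement_if :: "nat \<Rightarrow> bool \<Rightarrow> nat \<Rightarrow> nat"
  where "complement_if b t d = (if t then b - 1 - d else d)"

lemma complement_if_less: "d < b \<Longrightarrow> complement_if b t d < b"
  by (auto simp: complement_if_def)

lemma complement_if_complement_if:
  "d < b \<Longrightarrow> complement_if b t (complement_if b u d) = complement_if b (t \<noteq> u) d"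
  by (auto simp: complement_if_def)

locale digit_rotations =
  fixes b q :: nat
  assumes base: "1 < b" and len: "1 < q"
begin

text \<open>Digit positions are integers read modulo \<open>q\<close>, and a bit vector in \<open>(\<int>\<^sub>2)\<^sup>q\<close> is a
  \<open>q\<close>-periodic predicate on the integers.\<close>

definition cdigit :: "nat \<Rightarrow> int \<Rightarrow> nat"
  where "cdigit x j = digit b x (nat (j mod int q))"

definition periodic :: "(int \<Rightarrow> 'a) \<Rightarrow> bool"
  where "periodic A \<longleftrightarrow> (\<forall>j. A (j mod int q) = A j)"

lemma periodicD: "periodic A \<Longrightarrow> i mod int q = j mod int q \<Longrightarrow> A i = A j"
  unfolding periodic_def by metis

lemma periodicI: "(\<And>i j. i mod int q = j mod int q \<Longrightarrow> A i = A j) \<Longrightarrow> periodic A"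
  unfolding periodic_def using mod_mod_trivial by blast

lemma periodic_shift:
  assumes "periodic A" shows "periodic (\<lambda>j. A (j - g))"
  by (rule periodicI, rule periodicD[OF assms], rule mod_diff_cong) auto

lemma periodic_compose2:
  assumes "periodic A" "periodic B" shows "periodic (\<lambda>j. f (A j) (B j))"
  using assms by (simp add: periodic_def)

lemma mod_q_bounds: "0 \<le> j mod int q" "j mod int q < int q"
  using len by auto

lemma cdigit_less: "cdigit x j < b"
  using base by (simp add: cdigit_def digit_less)

lemma periodic_cdigit: "periodic (cdigit x)"
  by (rule periodicI) (simp add: cdigit_def)

lemma cdigit_eqI:
  assumes "x < b ^ q" "y < b ^ q" "\<And>j. cdigit x j = cdigit y j"
  shows "x = y"
proof (rule digits_eqI[OF assms(1,2)])
  fix j assume "j < q"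
  then show "digit b x j = digit b y j" using assms(3)[of "int j"] by (simp add: cdigit_def)
qed

lemma cdigit_exist:
  assumes "periodic f" "\<And>j. f j < b"
  obtains x where "x < b ^ q" "\<And>j. cdigit x j = f j"
proof -
  obtain x where x: "x < b ^ q" "\<forall>j<q. digit b x j = f (int j)"
    using digits_exist[of q "\<lambda>j. f (int j)" b] assms(2) by auto
  have "cdigit x j = f j" for j
  proof -
    have "cdigit x j = f (int (nat (j mod int q)))"
      using x(2) mod_q_bounds[of j] by (simp add: cdigit_def nat_less_iff)
    also have "\<dots> = f j" using mod_q_bounds[of j] assms(1) by (simp add: periodic_def)
    finally show ?thesis .
  qed
  with x(1) show ?thesis by (rule that)
qed

text \<open>The digit at position \<open>j - g\<close> moves to position \<open>j\<close>, and then
  the positions in \<open>A\<close> are complemented. Specifying the value by its digits lets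
  products be computed digit by digit.\<close>

definition perm :: "(int \<Rightarrow> bool) \<Rightarrow> int \<Rightarrow> nat \<Rightarrow> nat"
  where "perm A g = (\<lambda>x\<in>{..<b ^ q}. THE z. z < b ^ q \<and>
    (\<forall>j. cdigit z j = complement_if b (A j) (cdigit x (j - g))))"

lemma perm:
  assumes "periodic A" "x < b ^ q"
  shows perm_less: "perm A g x < b ^ q"
    and cdigit_perm: "cdigit (perm A g x) j = complement_if b (A j) (cdigit x (j - g))"
proof -
  let ?f = "\<lambda>j. complement_if b (A j) (cdigit x (j - g))"
  have "periodic ?f"
    by (rule periodic_compose2[OF assms(1) periodic_shift[OF periodic_cdigit]])
  then obtain z where "z < b ^ q" "\<And>j. cdigit z j = ?f j"
    by (rule cdigit_exist) (simp_all add: complement_if_less cdigit_less)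
  then have "\<exists>!z. z < b ^ q \<and> (\<forall>j. cdigit z j = ?f j)"
    by (intro ex1I[of _ z]) (auto intro: cdigit_eqI)
  from theI'[OF this] have "perm A g x < b ^ q \<and> (\<forall>j. cdigit (perm A g x) j = ?f j)"
    unfolding perm_def restrict_apply'[OF lessThan_iff[THEN iffD2, OF assms(2)]] .
  then show "perm A g x < b ^ q" "cdigit (perm A g x) j = ?f j" by blast+
qed

lemma permI:
  assumes "periodic A" "f \<in> extensional {..<b ^ q}" "\<And>x. x < b ^ q \<Longrightarrow> f x < b ^ q"
    and "\<And>x j. x < b ^ q \<Longrightarrow> cdigit (f x) j = complement_if b (A j) (cdigit x (j - g))"
  shows "f = perm A g"
proof (rule extensionalityI[of _ "{..<b ^ q}"])
  fix x assume "x \<in> {..<b ^ q}"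
  then show "f x = perm A g x"
    using assms(3,4)[of x] perm[OF assms(1), of x] by (auto intro!: cdigit_eqI[of "f x" "perm A g x"])
qed (simp_all only: assms(2), simp add: perm_def)

section \<open>The group law of rotations with complementations\<close>

lemma perm_cong: "periodic A \<Longrightarrow> g mod int q = h mod int q \<Longrightarrow> perm A g = perm A h"
proof (rule permI)
  fix x j assume "periodic A" "g mod int q = h mod int q" "x < b ^ q"
  moreover from this have "(j - g) mod int q = (j - h) mod int q" by (intro mod_diff_cong) auto
  then have "cdigit x (j - g) = cdigit x (j - h)" by (rule periodicD[OF periodic_cdigit])
  ultimately show "cdigit (perm A g x) j = complement_if b (A j) (cdigit x (j - h))"
    by (simp add: perm)
qed (auto simp: perm_less, auto simp: perm_def)

text \<open>This is the multiplication of a semidirect product: rotating by \<open>g\<close> carries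
  the earlier complementations \<open>B\<close> along.\<close>

lemma compose_perm:
  assumes "periodic A" "periodic B"
  shows "compose {..<b ^ q} (perm A g) (perm B h) = perm (\<lambda>j. A j \<noteq> B (j - g)) (g + h)"
proof (rule permI)
  show "periodic (\<lambda>j. A j \<noteq> B (j - g))"
    by (rule periodic_compose2[OF assms(1) periodic_shift[OF assms(2)]])
  fix x j assume x: "x < b ^ q"
  then show "cdigit (compose {..<b ^ q} (perm A g) (perm B h) x) j =
      complement_if b (A j \<noteq> B (j - g)) (cdigit x (j - (g + h)))"
    using cdigit_perm[OF assms(1) perm_less[OF assms(2) x]] cdigit_perm[OF assms(2) x]
    by (simp add: compose_eq complement_if_complement_if cdigit_less diff_diff_eq)
qed (simp_all add: compose_eq perm_less assms)

lemma perm_zero: "perm (\<lambda>_. False) 0 = (\<lambda>x\<in>{..<b ^ q}. x)"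
  by (rule permI[symmetric]) (simp_all add: periodic_def complement_if_def)

lemma perm_in_Bij:
  assumes "periodic A"
  shows "perm A g \<in> Bij {..<b ^ q}"
proof -
  \<comment> \<open>The candidate inverse rotates back by \<open>g\<close> and complements the
    positions of \<open>A\<close> pulled back by that rotation, so the complementations
    cancel.\<close>
  let ?B = "\<lambda>j. A (j - (- g))"
  have B: "periodic ?B" by (rule periodic_shift[OF assms])
  have "compose {..<b ^ q} (perm ?B (- g)) (perm A g) = (\<lambda>x\<in>{..<b ^ q}. x)"
    unfolding compose_perm[OF B assms] by (simp add: perm_zero)
  from fun_cong[OF this] have "perm ?B (- g) (perm A g x) = x" if "x < b ^ q" for x
    using that by (simp add: compose_def) (metis (no_types))
  then have "inj_on (perm A g) {..<b ^ q}"
    by (intro inj_on_inverseI[where g = "perm ?B (- g)"]) simp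
  then have "bij_betw (perm A g) {..<b ^ q} {..<b ^ q}"
    using perm_less[OF assms] by (intro bij_betw_finite_endoI) auto
  then show ?thesis by (simp add: Bij_def perm_def)
qed

lemma mult_perm:
  assumes "periodic A" "periodic B"
  shows "perm A g \<otimes>\<^bsub>BijGroup {..<b ^ q}\<^esub> perm B h = perm (\<lambda>j. A j \<noteq> B (j - g)) (g + h)"
  using assms by (simp add: BijGroup_def perm_in_Bij compose_perm)

lemma perm_inject:
  assumes A: "periodic A" and B: "periodic B" and eq: "perm A g = perm B h"
  shows "A = B" "g mod int q = h mod int q"
proof -
  \<comment> \<open>The all-zero word is fixed by every rotation, so its image shows the set of
    complemented positions; \<open>b > 1\<close> separates 0 from \<open>b - 1\<close>.\<close>
  obtain z where z: "z < b ^ q" "\<And>j. cdigit z j = 0"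
    using cdigit_exist[of "\<lambda>_. 0"] base by (auto simp: periodic_def)
  have "complement_if b (A j) 0 = complement_if b (B j) 0" for j
    using cdigit_perm[OF A z(1), of g j] cdigit_perm[OF B z(1), of h j] eq z(2) by simp
  then have "A j = B j" for j
    using base by (metis complement_if_def diff_zero not_gr_zero zero_less_diff)
  then show "A = B" by (rule ext)
  \<comment> \<open>A word with a single 1, at position 0, shows the rotation. The complementations,
    by now known to agree, are undone by applying them a second time.\<close>
  obtain u where u: "u < b ^ q" "\<And>j. cdigit u j = of_bool (j mod int q = 0)"
    by (rule cdigit_exist[of "\<lambda>j. of_bool (j mod int q = 0)"])
       (use base in \<open>auto simp: periodic_def\<close>)
  have "complement_if b (A g) 1 = complement_if b (A g) (cdigit u (g - h))"
    using cdigit_perm[OF A u(1), of g g] cdigit_perm[OF B u(1), of h g] eq u(2) \<open>A = B\<close> by simp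
  then have "complement_if b (A g) (complement_if b (A g) 1) =
      complement_if b (A g) (complement_if b (A g) (cdigit u (g - h)))" by simp
  then have "cdigit u (g - h) = 1"
    using base cdigit_less[of u] by (simp add: complement_if_complement_if) (simp add: complement_if_def)
  then have "(g - h) mod int q = 0" using u(2) by (auto split: if_splits simp: of_bool_def)
  then show "g mod int q = h mod int q" by (simp add: mod_eq_dvd_iff mod_eq_0_iff_dvd)
qed

section \<open>The shuffles as rotations of the digits\<close>

lemma cdigit_rotate:
  assumes "s < q" "x < b ^ q" "w < b ^ s"
  shows "cdigit (x mod b ^ (q - s) * b ^ s + w) j =
    (if j mod int q < int s then digit b w (nat (j mod int q)) else cdigit x (j - int s))"
proof (cases "j mod int q < int s")
  case True
  then show ?thesis using assms(3) len
    by (simp add: cdigit_def digit_append nat_less_iff)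
next
  case False
  define i where "i = nat (j mod int q)"
  have i: "j mod int q = int i" "s \<le> i" "i < q"
    using False mod_q_bounds[of j] by (simp_all add: i_def nat_less_iff)
  have "(j - int s) mod int q = (int i - int s) mod int q"
    using i(1) by (metis mod_diff_left_eq)
  also have "\<dots> = int (i - s)" using i by (simp add: of_nat_diff[symmetric] del: of_nat_diff)
  finally have "cdigit x (j - int s) = digit b x (i - s)" by (simp add: cdigit_def)
  then show ?thesis using False assms i base
    by (simp add: cdigit_def digit_append digit_mod)
qed

text \<open>The \<open>s\<close> top digits are those that a rotation by \<open>s\<close> brings
  around to the \<open>s\<close> lowest places.\<close>

lemma cdigit_wrap:
  assumes "s < q" "j mod int q < int s"
  shows "digit b (x div b ^ (q - s)) (nat (j mod int q)) = cdigit x (j - int s)"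
proof -
  define i where "i = nat (j mod int q)"
  have i: "j mod int q = int i" "i < s"
    using assms(2) mod_q_bounds[of j] by (simp_all add: i_def nat_less_iff)
  have "(j - int s) mod int q = (int i - int s) mod int q"
    using i(1) by (metis mod_diff_left_eq)
  \<comment> \<open>Here \<open>i < s\<close>, so one period is added to reach the representative
    between 0 and \<open>q - 1\<close>.\<close>
  also have "\<dots> = (int i - int s + int q) mod int q" by simp
  also have "int i - int s + int q = int (i + (q - s))" using assms(1) by simp
  also have "int (i + (q - s)) mod int q = int (i + (q - s))" using i assms(1) by (intro mod_pos_pos_trivial) auto
  finally have "nat ((j - int s) mod int q) = i + (q - s)" by (simp only: nat_int)
  then show ?thesis using i by (simp add: cdigit_def digit_div)
qed

text \<open>The stack index is the block of the \<open>s\<close> top digits, and both shuffles move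
  the remaining digits up and put a block below them. The in shuffle puts \<open>b ^ s - 1\<close>
  minus the stack index there, which complements each digit of the block.\<close>

lemma shuffle_perm:
  assumes "s < q"
  shows out_shuffle_eq_perm: "out_shuffle (b ^ s) (b ^ (q - s)) = perm (\<lambda>_. False) (int s)"
    and in_shuffle_eq_perm:
      "in_shuffle (b ^ s) (b ^ (q - s)) = perm (\<lambda>j. j mod int q < int s) (int s)"
proof -
  have pow: "b ^ s * b ^ (q - s) = b ^ q" using assms by (simp flip: power_add)
  have le: "x div b ^ (q - s) < b ^ s" if "x < b ^ q" for x
    using that pow stack_less[of x "b ^ s" "b ^ (q - s)"] by simp
  have "out_shuffle (b ^ s) (b ^ (q - s)) \<in> Bij {..<b ^ q}"
    "in_shuffle (b ^ s) (b ^ (q - s)) \<in> Bij {..<b ^ q}"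
    using out_shuffle_in_BijGroup[of "b ^ s" "b ^ (q - s)"]
      in_shuffle_in_BijGroup[of "b ^ s" "b ^ (q - s)"] by (simp_all add: pow BijGroup_def)
  note mem = Bij_imp_extensional[OF this(1)] Bij_imp_extensional[OF this(2)]
    Bij_imp_funcset[OF this(1)] Bij_imp_funcset[OF this(2)]
  show "out_shuffle (b ^ s) (b ^ (q - s)) = perm (\<lambda>_. False) (int s)"
  proof (rule permI)
    fix x j assume x: "x < b ^ q"
    then show "cdigit (out_shuffle (b ^ s) (b ^ (q - s)) x) j = complement_if b False (cdigit x (j - int s))"
      using cdigit_rotate[OF assms x le[OF x]] cdigit_wrap[OF assms]
      by (simp add: out_shuffle_def pow complement_if_def)
  qed (use mem in \<open>auto simp: periodic_def\<close>)
  show "in_shuffle (b ^ s) (b ^ (q - s)) = perm (\<lambda>j. j mod int q < int s) (int s)"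
  proof (rule permI)
    fix x j assume x: "x < b ^ q"
    have less: "b ^ s - 1 - x div b ^ (q - s) < b ^ s" using base by simp
    have "nat (j mod int q) < s" if "j mod int q < int s"
      using that assms mod_q_bounds[of j] by (simp add: nat_less_iff)
    then have *: "digit b (b ^ s - 1 - x div b ^ (q - s)) (nat (j mod int q)) =
        b - 1 - cdigit x (j - int s)" if "j mod int q < int s"
      using digit_complement[OF _ le[OF x]] base that cdigit_wrap[OF assms that] by simp
    show "cdigit (in_shuffle (b ^ s) (b ^ (q - s)) x) j =
        complement_if b (j mod int q < int s) (cdigit x (j - int s))"
      using cdigit_rotate[OF assms x less, of j] x *
      by (simp add: in_shuffle_def pow complement_if_def)
  qed (use mem in \<open>auto simp: periodic_def\<close>)
qed

end

section \<open>The group generated by the two shuffles\<close>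

locale shuffle_pair = digit_rotations +
  fixes s :: nat
  assumes s_pos: "0 < s" and s_less: "s < q" and coprime: "coprime s q"
begin

text \<open>The coefficient vector of 1 + x + ... + x^(s-1): the positions that the in shuffle
  complements.\<close>

definition initial :: "int \<Rightarrow> bool"
  where "initial = (\<lambda>j. j mod int q < int s)"

definition shuffles :: "(nat \<Rightarrow> nat) set"
  where "shuffles = generate (BijGroup {..<b ^ q}) {perm initial (int s), perm (\<lambda>_. False) (int s)}"

text \<open>The part of the group without rotation. It is shown below to be closed under sums and
  cyclic shifts, so it is a submodule of the group ring of the rotations over the field with two
  elements.\<close>

definition complements :: "(int \<Rightarrow> bool) set"
  where "complements = {A. periodic A \<and> perm A 0 \<in> shuffles}"

definition single :: "int \<Rightarrow> int \<Rightarrow> bool"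
  where "single d = (\<lambda>j. j mod int q = d mod int q)"

lemma periodic_False: "periodic (\<lambda>_. False)"
  by (simp add: periodic_def)

lemma periodic_initial: "periodic initial"
  by (simp add: periodic_def initial_def)

lemma perm_in_carrier: "periodic A \<Longrightarrow> perm A g \<in> carrier (BijGroup {..<b ^ q})"
  using perm_in_Bij by (simp add: BijGroup_def)

lemma generators_in_carrier:
  "{perm initial (int s), perm (\<lambda>_. False) (int s)} \<subseteq> carrier (BijGroup {..<b ^ q})"
  by (simp add: perm_in_carrier periodic_initial periodic_False)

lemma subgroup_shuffles: "subgroup shuffles (BijGroup {..<b ^ q})"
  unfolding shuffles_def
  by (rule group.generate_is_subgroup[OF group_BijGroup generators_in_carrier])

lemma mult_shuffles:
  assumes "periodic A" "periodic B" "perm A g \<in> shuffles" "perm B h \<in> shuffles"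
  shows "perm (\<lambda>j. A j \<noteq> B (j - g)) (g + h) \<in> shuffles"
  using subgroup.m_closed[OF subgroup_shuffles assms(3,4)] mult_perm[OF assms(1,2)] by simp

text \<open>By Bezout, \<open>s\<close> is invertible modulo \<open>q\<close>. Reducing the factor
  modulo \<open>q\<close> makes it a natural number, which permits induction on it.\<close>

lemma multiple_exists:
  obtains n where "int n * int s mod int q = g mod int q"
proof -
  obtain x z where "x * int s + z * int q = gcd (int s) (int q)"
    using bezout_int by blast
  moreover have "gcd (int s) (int q) = 1" using coprime by simp
  ultimately have "g * (x * int s + z * int q) = g" by simp
  then have "(g * x * int s + g * z * int q) mod int q = g mod int q"
    by (simp add: algebra_simps)
  then have "int (nat ((g * x) mod int q)) * int s mod int q = g mod int q"
    using mod_q_bounds[of "g * x"] by (simp add: mod_mult_left_eq)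
  then show ?thesis by (rule that)
qed

text \<open>The powers of the out shuffle are the rotations by multiples of \<open>s\<close>, and
  these exhaust all residues.\<close>

lemma rotation_in_shuffles: "perm (\<lambda>_. False) g \<in> shuffles"
proof -
  have pow: "perm (\<lambda>_. False) (int n * int s) \<in> shuffles" for n
  proof (induction n)
    case 0
    then show ?case
      using subgroup.one_closed[OF subgroup_shuffles] by (simp add: BijGroup_def flip: perm_zero)
  next
    case (Suc n)
    have "perm (\<lambda>_. False) (int s) \<in> shuffles"
      by (simp add: shuffles_def generate.incl)
    from mult_shuffles[OF periodic_False periodic_False Suc this] show ?case
      by (simp add: algebra_simps)
  qed
  obtain n where "int n * int s mod int q = g mod int q" by (rule multiple_exists)
  with pow periodic_False show ?thesis by (metis perm_cong)
qed

lemma complements_periodic: "A \<in> complements \<Longrightarrow> periodic A"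
  by (simp add: complements_def)

lemma perm_in_shuffles:
  assumes "A \<in> complements" shows "perm A g \<in> shuffles"
  using mult_shuffles[OF _ periodic_False _ rotation_in_shuffles, of A 0 g] assms
  by (simp add: complements_def)

lemma complements_False: "(\<lambda>_. False) \<in> complements"
  by (simp add: complements_def periodic_False rotation_in_shuffles)

lemma complements_xor:
  assumes "A \<in> complements" "B \<in> complements"
  shows "(\<lambda>j. A j \<noteq> B j) \<in> complements"
  using mult_shuffles[of A B 0 0] assms periodic_compose2[of A B "\<lambda>x y. x \<noteq> y"]
  by (simp add: complements_def)

text \<open>Conjugating \<open>perm A 0\<close> by the rotation by \<open>g\<close> shifts
  \<open>A\<close> by \<open>g\<close>.\<close>

lemma complements_shift:
  assumes "A \<in> complements"
  shows "(\<lambda>j. A (j - g)) \<in> complements"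
proof -
  have A: "periodic A" "periodic (\<lambda>j. A (j - g))"
    using assms periodic_shift[of A g] by (simp_all add: complements_def)
  have "perm (\<lambda>j. A (j - g)) g \<in> shuffles"
    using mult_shuffles[OF periodic_False A(1) rotation_in_shuffles, of 0 g] assms
    by (simp add: complements_def)
  then show ?thesis
    using mult_shuffles[OF A(2) periodic_False _ rotation_in_shuffles, of g "- g"] A
    by (simp add: complements_def)
qed

text \<open>The in shuffle followed by a suitable rotation has no rotation left. In the product
  below, the rotation by \<open>- s\<close> is the right factor, so \<open>initial\<close> is not
  shifted.\<close>

lemma complements_initial: "initial \<in> complements"
proof -
  have "perm initial (int s) \<in> shuffles" by (simp add: shuffles_def generate.incl)
  then show ?thesis
    using mult_shuffles[OF periodic_initial periodic_False _ rotation_in_shuffles, of "int s" "- int s"]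
      periodic_initial by (simp add: complements_def)
qed

section \<open>The complementations generated by the shuffles\<close>

lemma single_shift: "single d (j - g) = single (d + g) j"
  by (simp add: single_def mod_eq_dvd_iff algebra_simps)

lemma mod_pred: "(j - 1) mod int q = (if j mod int q = 0 then int q - 1 else j mod int q - 1)"
proof -
  have *: "(j - 1) mod int q = (j mod int q - 1) mod int q" by (simp add: mod_diff_left_eq)
  show ?thesis
  proof (cases "j mod int q = 0")
    case True
    have "(- 1) mod int q = int q - 1" using len by (simp add: zmod_minus1)
    with * True show ?thesis by simp
  next
    case False
    then have "(j mod int q - 1) mod int q = j mod int q - 1"
      using mod_q_bounds[of j] by (intro mod_pos_pos_trivial) linarith+
    with * False show ?thesis by simp
  qed
qed

text \<open>Over the group ring of \<open>\<int>\<^sub>q\<close>, this is \<open>(1 + x + \<dots> + x\<^bsup>s-1\<^esup>)(x - 1) = x\<^sup>s - 1\<close>.\<close>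

lemma single_s_in_complements: "(\<lambda>j. single 0 j \<noteq> single (int s) j) \<in> complements"
proof -
  have "(initial j \<noteq> initial (j - 1)) = (single 0 j \<noteq> single (int s) j)" for j
    using mod_q_bounds[of j] s_pos s_less by (auto simp: initial_def single_def mod_pred)
  then show ?thesis
    using complements_xor[OF complements_initial complements_shift[OF complements_initial, of 1]]
    by simp
qed

text \<open>A telescoping sum of shifts of x^s - 1 gives x^(ns) - 1, and \<open>n\<close> can be
  chosen so that ns is congruent to \<open>d\<close>.\<close>

lemma single_pair_in_complements: "(\<lambda>j. single 0 j \<noteq> single d j) \<in> complements"
proof -
  have mult: "(\<lambda>j. single 0 j \<noteq> single (int n * int s) j) \<in> complements" for n
  proof (induction n)
    case 0
    then show ?case by (simp add: complements_False)
  next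
    case (Suc n)
    have "(\<lambda>j. single (int n * int s) j \<noteq> single (int s + int n * int s) j) \<in> complements"
      using complements_shift[OF single_s_in_complements, of "int n * int s"]
      by (simp add: single_shift)
    from complements_xor[OF Suc this]
    have "(\<lambda>j. single 0 j \<noteq> single (int s + int n * int s) j) \<in> complements"
      by (rule back_subst[of "\<lambda>A. A \<in> complements"]) auto
    then show ?case by (simp add: algebra_simps)
  qed
  obtain n where "int n * int s mod int q = d mod int q" by (rule multiple_exists)
  then have "single (int n * int s) = single d" by (simp add: single_def)
  with mult[of n] show ?thesis by simp
qed

text \<open>The difference map is linear, so unit vectors suffice; it sends x^t to x^t + x^(t-1), a
  shift of a known element.\<close>

lemma boundary_in_complements:
  fixes A :: "int \<Rightarrow> bool"
  assumes "periodic A"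
  shows "(\<lambda>j. A j \<noteq> A (j + 1)) \<in> complements"
proof -
  have "(\<lambda>j. (j mod int q \<in> T) \<noteq> ((j + 1) mod int q \<in> T)) \<in> complements"
    if "finite T" "T \<subseteq> {0..<int q}" for T
    using that
  proof (induction T)
    case empty
    then show ?case by (simp add: complements_False)
  next
    case (insert t T)
    have "(\<lambda>j. single t j \<noteq> single (t - 1) j) \<in> complements"
      using complements_shift[OF single_pair_in_complements[of "-1"], of t]
      by (simp add: single_shift)
    from complements_xor[OF this insert.IH] insert.prems
    have "(\<lambda>j. (single t j \<noteq> single (t - 1) j) \<noteq>
        ((j mod int q \<in> T) \<noteq> ((j + 1) mod int q \<in> T))) \<in> complements" by simp
    moreover have "t mod int q = t" using insert.prems by simp
    then have "(j mod int q \<in> insert t T) = (single t j \<noteq> (j mod int q \<in> T))"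
      "((j + 1) mod int q \<in> insert t T) = (single (t - 1) j \<noteq> ((j + 1) mod int q \<in> T))" for j
      using single_shift[of t j "-1"] insert.hyps(2) by (auto simp: single_def)
    ultimately show ?case
      by (elim back_subst[of "\<lambda>A. A \<in> complements"]) auto
  qed
  from this[of "{t \<in> {0..<int q}. A t}", OF finite_subset[of _ "{0..<int q}"]] show ?thesis
    using assms mod_q_bounds by (simp add: periodic_def subset_eq)
qed

text \<open>A vector of odd weight, here \<open>initial\<close>, differs from a unit vector by one
  of even weight; the shifts of a unit vector then span everything.\<close>

lemma odd_imp_in_complements:
  assumes "odd s" "periodic A"
  shows "A \<in> complements"
proof -
  \<comment> \<open>The positions 2, 4, ..., \<open>s - 1\<close>. Each pairs with its predecessor,
    so the boundary of \<open>E\<close> is 1, ..., \<open>s - 1\<close> and leaves just position 0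
    of \<open>initial\<close>.\<close>
  define E where "E = (\<lambda>j. even (j mod int q) \<and> 0 < j mod int q \<and> j mod int q < int s)"
  have E: "periodic E" by (simp add: periodic_def E_def)
  \<comment> \<open>Since \<open>s\<close> is odd, no pair crosses the end of the block: an even
    successor of a position below \<open>s\<close> is below \<open>s\<close> itself.\<close>
  have "x < int s" if "x - 1 < int s" "even x" for x
    using that assms(1) by (cases "x = int s") auto
  from this[of "(j + 1) mod int q" for j]
  have "(initial j \<noteq> (E j \<noteq> E (j + 1))) = single 0 j" for j
    using mod_q_bounds[of j] mod_pred[of "j + 1"] mod_q_bounds[of "j + 1"] s_pos s_less assms(1)
    by (auto simp: initial_def single_def E_def split: if_splits)
  then have single0: "single 0 \<in> complements"
    using complements_xor[OF complements_initial boundary_in_complements[OF E]] by simp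
  \<comment> \<open>Every periodic predicate is a finite sum of unit vectors, one for each residue
    in \<open>T\<close>.\<close>
  have "(\<lambda>j. j mod int q \<in> T) \<in> complements" if "finite T" "T \<subseteq> {0..<int q}" for T
    using that
  proof (induction T)
    case empty
    then show ?case by (simp add: complements_False)
  next
    case (insert t T)
    have "single t \<in> complements"
      using complements_shift[OF single0, of t] by (simp add: single_shift)
    from complements_xor[OF this insert.IH] insert.prems
    have "(\<lambda>j. single t j \<noteq> (j mod int q \<in> T)) \<in> complements" by simp
    moreover have "t mod int q = t" using insert.prems by simp
    then have "(j mod int q \<in> insert t T) = (single t j \<noteq> (j mod int q \<in> T))" for j
      using insert.hyps(2) by (auto simp: single_def)
    ultimately show ?case
      by (elim back_subst[of "\<lambda>A. A \<in> complements"]) auto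
  qed
  from this[of "{t \<in> {0..<int q}. A t}", OF finite_subset[of _ "{0..<int q}"]] show ?thesis
    using assms mod_q_bounds by (simp add: periodic_def subset_eq)
qed

section \<open>Isomorphism with a semidirect product\<close>

text \<open>An injective map from \<open>N\<close> to bit vectors that carries \<open>\<sigma>\<close> to the cyclic shift forces
  \<open>\<sigma>\<close> to be an automorphism with \<open>\<sigma>\<^sup>q = 1\<close>.\<close>

lemma shuffles_iso_semidirect:
  fixes N :: "('a, 'c) monoid_scheme" and u :: "'a \<Rightarrow> int \<Rightarrow> bool" and \<sigma> :: "'a \<Rightarrow> 'a"
  assumes N: "group N"
    and periodic_u: "\<And>a. periodic (u a)"
    and inj_u: "inj_on u (carrier N)"
    and mult_u: "\<And>a b j. a \<in> carrier N \<Longrightarrow> b \<in> carrier N \<Longrightarrow> u (a \<otimes>\<^bsub>N\<^esub> b) j = (u a j \<noteq> u b j)"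
    and u_complements: "\<And>a. a \<in> carrier N \<Longrightarrow> u a \<in> complements"
    and u_initial: "initial \<in> u ` carrier N"
    and \<sigma>: "\<sigma> \<in> extensional (carrier N)" "\<And>a. a \<in> carrier N \<Longrightarrow> \<sigma> a \<in> carrier N"
    and u_\<sigma>: "\<And>a j. a \<in> carrier N \<Longrightarrow> u (\<sigma> a) j = u a (j - 1)"
  shows "\<exists>\<phi>. cyclic_action q N \<sigma> \<phi> \<and>
    subgroup_generated (BijGroup {..<b ^ q}) {perm initial (int s), perm (\<lambda>_. False) (int s)} \<cong>
      semidirect_product N (integer_mod_group q) \<phi>"
proof -
  interpret N: group N by fact
  let ?Z = "integer_mod_group q"
  have Z: "carrier ?Z = {0..<int q}" using len by (simp add: carrier_integer_mod_group)
  have eqI: "a = c" if "a \<in> carrier N" "c \<in> carrier N" "\<And>j. u a j = u c j" for a c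
    using inj_onD[OF inj_u _ that(1,2)] that(3) by blast
  \<comment> \<open>The image of the identity equals its sum with itself, so it vanishes.\<close>
  have u_one: "u \<one>\<^bsub>N\<^esub> = (\<lambda>_. False)"
    using mult_u[of "\<one>\<^bsub>N\<^esub>" "\<one>\<^bsub>N\<^esub>"] by auto
  have funpow: "(\<sigma> ^^ n) a \<in> carrier N \<and> (\<forall>j. u ((\<sigma> ^^ n) a) j = u a (j - int n))"
    if "a \<in> carrier N" for a n
    by (induction n) (use that in \<open>auto simp: \<sigma> u_\<sigma> diff_diff_eq\<close>)
  \<comment> \<open>Elements of \<open>?Z\<close> are representatives between 0 and
    \<open>q - 1\<close>, so \<open>g\<close> serves as an iteration count; the restriction supplies
    the extensionality that \<open>auto N\<close> demands.\<close>
  define \<phi> where "\<phi> g = restrict (\<sigma> ^^ nat g) (carrier N)" for g :: int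
  have ext_\<phi>: "\<phi> g \<in> extensional (carrier N)" for g by (simp add: \<phi>_def)
  have closed: "\<phi> g a \<in> carrier N" if "a \<in> carrier N" for g a
    using funpow[OF that] that by (simp add: \<phi>_def)
  have u_\<phi>: "u (\<phi> g a) j = u a (j - g)" if "a \<in> carrier N" "0 \<le> g" for g a j
    using funpow[OF that(1), of "nat g"] that by (simp add: \<phi>_def)
  have hom_\<phi>: "\<phi> g \<in> hom N N" if "0 \<le> g" for g
    using that by (auto intro!: homI closed eqI simp: mult_u u_\<phi> closed)
  \<comment> \<open>This contains the relation that the \<open>q\<close>-th iterate of
    \<open>\<sigma>\<close> is the identity: both sides shift \<open>u a\<close> by congruent
    amounts, and \<open>u\<close> is injective.\<close>
  have comp_\<phi>: "\<phi> g (\<phi> h a) = \<phi> ((g + h) mod int q) a"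
    if "a \<in> carrier N" "0 \<le> g" "0 \<le> h" for g h a
  proof (rule eqI)
    fix j
    have "(j - h - g) mod int q = (j - (g + h) mod int q) mod int q"
      by (simp add: mod_diff_right_eq algebra_simps)
    then have "u a (j - h - g) = u a (j - (g + h) mod int q)"
      by (rule periodicD[OF periodic_u])
    then show "u (\<phi> g (\<phi> h a)) j = u (\<phi> ((g + h) mod int q) a) j"
      using that mod_q_bounds by (simp add: u_\<phi> closed algebra_simps)
  qed (use that closed in auto)
  have \<phi>_zero: "\<phi> 0 a = a" if "a \<in> carrier N" for a
    using that by (simp add: \<phi>_def)
  have auto_\<phi>: "\<phi> g \<in> auto N" if "0 \<le> g" for g
  proof -
    \<comment> \<open>The nonnegative representative of \<open>- g\<close> yields a two-sided
      inverse.\<close>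
    let ?h = "(- g) mod int q"
    have "\<phi> ?h (\<phi> g a) = a \<and> \<phi> g (\<phi> ?h a) = a" if "a \<in> carrier N" for a
      using that \<open>0 \<le> g\<close> mod_q_bounds
      by (simp add: comp_\<phi> \<phi>_zero mod_add_left_eq mod_add_right_eq)
    then have "bij_betw (\<phi> g) (carrier N) (carrier N)"
      by (intro bij_betw_byWitness[where f' = "\<phi> ?h"]) (auto intro: closed)
    then show ?thesis using hom_\<phi>[OF that] by (simp add: auto_def Bij_def ext_\<phi>)
  qed
  have action: "\<phi> \<in> hom ?Z (AutoGroup N)"
  proof (rule homI)
    fix g h assume "g \<in> carrier ?Z" "h \<in> carrier ?Z"
    then have gh: "0 \<le> g" "0 \<le> h" by (auto simp: Z)
    have "\<phi> ((g + h) mod int q) = compose (carrier N) (\<phi> g) (\<phi> h)"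
      by (rule extensionalityI[of _ "carrier N"]) (simp_all add: ext_\<phi> compose_eq comp_\<phi> gh)
    then show "\<phi> (g \<otimes>\<^bsub>?Z\<^esub> h) = \<phi> g \<otimes>\<^bsub>AutoGroup N\<^esub> \<phi> h"
      using auto_\<phi>[OF gh(1)] auto_\<phi>[OF gh(2)] by (simp add: AutoGroup_def BijGroup_def auto_def)
  qed (simp add: Z AutoGroup_def auto_\<phi>)
  have "\<phi> 1 = \<sigma>"
    by (rule extensionalityI[of _ "carrier N"]) (simp_all add: \<phi>_def \<sigma>)
  with action have cyc: "cyclic_action q N \<sigma> \<phi>" by (simp add: cyclic_action_def)

  let ?W = "semidirect_product N ?Z \<phi>" and ?S = "BijGroup {..<b ^ q}"
  let ?gens = "{perm initial (int s), perm (\<lambda>_. False) (int s)}"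
  define \<Psi> where "\<Psi> = (\<lambda>(a, g). perm (u a) g)"
  have W: "group ?W" by (rule group_semidirect_product[OF N group_integer_mod_group action])
  have hom: "\<Psi> \<in> hom ?W ?S"
  proof (rule homI)
    fix x y assume "x \<in> carrier ?W" "y \<in> carrier ?W"
    then obtain a g c h where xy: "x = (a, g)" "y = (c, h)" "a \<in> carrier N" "c \<in> carrier N" "0 \<le> g"
      by (auto simp: semidirect_product_def Z)
    have "u (a \<otimes>\<^bsub>N\<^esub> \<phi> g c) = (\<lambda>j. u a j \<noteq> u c (j - g))"
      using xy by (auto simp: mult_u closed u_\<phi>)
    \<comment> \<open>Addition in \<open>?Z\<close> reduces modulo \<open>q\<close>, which a
      rotation of \<open>q\<close> digits does not notice.\<close>
    moreover from this have "perm (u (a \<otimes>\<^bsub>N\<^esub> \<phi> g c)) ((g + h) mod int q) =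
        perm (u (a \<otimes>\<^bsub>N\<^esub> \<phi> g c)) (g + h)"
      by (intro perm_cong periodic_u) simp
    ultimately show "\<Psi> (x \<otimes>\<^bsub>?W\<^esub> y) = \<Psi> x \<otimes>\<^bsub>?S\<^esub> \<Psi> y"
      using xy by (simp add: \<Psi>_def semidirect_product_def mult_perm periodic_u)
  qed (auto simp: \<Psi>_def periodic_u perm_in_carrier)
  have inj: "inj_on \<Psi> (carrier ?W)"
  proof (rule inj_onI)
    fix x y assume "x \<in> carrier ?W" "y \<in> carrier ?W" and eq: "\<Psi> x = \<Psi> y"
    then obtain a g c h where xy: "x = (a, g)" "y = (c, h)" "a \<in> carrier N" "c \<in> carrier N"
        "g \<in> {0..<int q}" "h \<in> {0..<int q}"
      by (auto simp: semidirect_product_def Z)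
    have "perm (u a) g = perm (u c) h" using eq xy by (simp add: \<Psi>_def)
    from perm_inject[OF periodic_u periodic_u this] have "u a = u c" "g mod int q = h mod int q" .
    then show "x = y" using xy eqI[of a c] by simp
  qed
  interpret \<Psi>: group_hom ?W ?S \<Psi>
    by (intro group_hom.intro group_hom_axioms.intro W hom group_BijGroup)
  have shuffles: "carrier (subgroup_generated ?S ?gens) = shuffles"
    unfolding carrier_subgroup_generated shuffles_def
    using generators_in_carrier by (simp add: Int_absorb1)
  have "\<Psi> ` carrier ?W = shuffles"
  proof
    show "\<Psi> ` carrier ?W \<subseteq> shuffles"
      by (auto simp: \<Psi>_def semidirect_product_def u_complements perm_in_shuffles)
    \<comment> \<open>Conversely, the image is a subgroup containing both generators: their rotation
      part is \<open>s\<close>, their complementation part \<open>initial\<close> or zero.\<close>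
    obtain w where "w \<in> carrier N" "u w = initial" using u_initial by (metis imageE)
    then have "(w, int s) \<in> carrier ?W" "\<Psi> (w, int s) = perm initial (int s)"
      "(\<one>\<^bsub>N\<^esub>, int s) \<in> carrier ?W" "\<Psi> (\<one>\<^bsub>N\<^esub>, int s) = perm (\<lambda>_. False) (int s)"
      using s_less by (simp_all add: semidirect_product_def Z \<Psi>_def u_one)
    then have "?gens \<subseteq> \<Psi> ` carrier ?W" by (metis empty_subsetI image_eqI insert_subset)
    then show "shuffles \<subseteq> \<Psi> ` carrier ?W"
      unfolding shuffles_def
      by (rule group.generate_subgroup_incl[OF group_BijGroup _ \<Psi>.img_is_subgroup])
  qed
  then have "\<Psi> \<in> iso ?W (subgroup_generated ?S ?gens)"
    using hom inj shuffles by (auto intro!: isoI homI simp: bij_betw_def hom_mult)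
  then have "?W \<cong> subgroup_generated ?S ?gens" by (rule is_isoI)
  then have "subgroup_generated ?S ?gens \<cong> ?W" by (rule group.iso_sym[OF W])
  with cyc show ?thesis by blast
qed

section \<open>The two cases, according to the parity of \<open>s\<close>\<close>

lemma shuffles_iso_cyclic_shift:
  assumes "odd s"
  shows "\<exists>\<phi>. cyclic_action q (Z2_power q) (cyclic_shift q) \<phi> \<and>
    subgroup_generated (BijGroup {..<b ^ q}) {perm initial (int s), perm (\<lambda>_. False) (int s)} \<cong>
      semidirect_product (Z2_power q) (integer_mod_group q) \<phi>"
\<comment> \<open>The \<open>+ 1\<close> translates digit positions, counted from 0, into vector
  indices, counted from 1.\<close>
proof (rule shuffles_iso_semidirect[where u = "\<lambda>a j. a (nat (j mod int q) + 1) = 1"])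
  have idx: "nat (j mod int q) + 1 \<in> {1..q}" for j
    using mod_q_bounds[of j] by (simp add: nat_less_iff Suc_le_eq)
  have bit: "a i = 0 \<or> a i = 1" if "a \<in> carrier (Z2_power q)" "i \<in> {1..q}" for a i
    using that PiE_mem[of a "{1..q}" "\<lambda>_. {0..<2}" i] by (auto simp: carrier_integer_mod_group)
  show "group (Z2_power q)" by simp
  show per: "periodic (\<lambda>j. a (nat (j mod int q) + 1) = 1)" for a :: "nat \<Rightarrow> int"
    by (simp add: periodic_def)
  then show "(\<lambda>j. a (nat (j mod int q) + 1) = 1) \<in> complements" for a :: "nat \<Rightarrow> int"
    using odd_imp_in_complements[OF assms] by blast
  show "inj_on (\<lambda>a j. a (nat (j mod int q) + 1) = 1) (carrier (Z2_power q))"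
  proof (rule inj_onI)
    fix a c assume ac: "a \<in> carrier (Z2_power q)" "c \<in> carrier (Z2_power q)"
      and eq: "(\<lambda>j. a (nat (j mod int q) + 1) = 1) = (\<lambda>j. c (nat (j mod int q) + 1) = 1)"
    show "a = c"
    proof (rule PiE_ext)
      fix i assume i: "i \<in> {1..q}"
      moreover obtain i' where "i = Suc i'" using i by (cases i) auto
      ultimately show "a i = c i"
        using fun_cong[OF eq, of "int i'"] bit[OF ac(1) i] bit[OF ac(2) i] by auto
    qed (use ac in auto)
  qed
  show "((a \<otimes>\<^bsub>Z2_power q\<^esub> c) (nat (j mod int q) + 1) = 1) =
      ((a (nat (j mod int q) + 1) = 1) \<noteq> (c (nat (j mod int q) + 1) = 1))"
    if "a \<in> carrier (Z2_power q)" "c \<in> carrier (Z2_power q)" for a c j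
    using bit[OF that(1) idx[of j]] bit[OF that(2) idx[of j]] idx[of j] by auto
  \<comment> \<open>The indices 1, ..., \<open>s\<close> stand for the positions 0, ...,
    \<open>s - 1\<close> of \<open>initial\<close>.\<close>
  let ?w = "\<lambda>i\<in>{1..q}. of_bool (i \<le> s) :: int"
  have w: "?w \<in> carrier (Z2_power q)" by (auto simp: carrier_integer_mod_group)
  have w_initial: "initial = (\<lambda>j. ?w (nat (j mod int q) + 1) = 1)"
  proof
    fix j
    show "initial j = (?w (nat (j mod int q) + 1) = 1)"
      using idx[of j] mod_q_bounds[of j] by (auto simp: initial_def nat_less_iff Suc_le_eq)
  qed
  show "initial \<in> (\<lambda>a j. a (nat (j mod int q) + 1) = 1) ` carrier (Z2_power q)"
    by (rule image_eqI[where x = ?w]) (rule w_initial, rule w)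
  show "cyclic_shift q \<in> extensional (carrier (Z2_power q))" by (simp add: cyclic_shift_def)
  show "cyclic_shift q a \<in> carrier (Z2_power q)" if "a \<in> carrier (Z2_power q)" for a
  proof -
    have "a i \<in> carrier (integer_mod_group 2)" if "1 \<le> i" "i \<le> q" for i
      using PiE_mem[of a "{1..q}" _ i] \<open>a \<in> carrier (Z2_power q)\<close> that by simp
    with that show ?thesis by (auto simp: cyclic_shift_def)
  qed
  show "(cyclic_shift q a (nat (j mod int q) + 1) = 1) = (a (nat ((j - 1) mod int q) + 1) = 1)"
    if "a \<in> carrier (Z2_power q)" for a j
  proof -
    \<comment> \<open>Position 0 takes its value from position \<open>q - 1\<close>, whose index
      \<open>q\<close> is the entry that \<open>cyclic_shift\<close> wraps around.\<close>
    have "nat (int q - 1) + 1 = q" using len by simp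
    moreover have "j mod int q \<noteq> 0 \<Longrightarrow> nat (j mod int q - 1) + 1 = nat (j mod int q)"
      using mod_q_bounds[of j] by linarith
    ultimately show ?thesis
      using that idx[of j] mod_q_bounds[of j] by (auto simp: cyclic_shift_def mod_pred)
  qed
qed

text \<open>Read \<open>(a\<^sub>1, \<dots>, a\<^bsub>q-1\<^esub>)\<close> as a bit vector on \<open>\<int>\<^sub>q\<close> with \<open>a\<^sub>0 = 0\<close>, that is, as a vector
  modulo constants. The twisted shift is then the cyclic shift modulo constants, and
  \<open>a \<mapsto> (a\<^sub>j + a\<^bsub>j+1\<^esub>)\<^sub>j\<close> identifies these vectors with those of even weight.\<close>

definition zero_extend :: "(nat \<Rightarrow> int) \<Rightarrow> int \<Rightarrow> bool"
  where "zero_extend a j \<longleftrightarrow> j mod int q \<noteq> 0 \<and> a (nat (j mod int q)) = 1"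

lemma periodic_zero_extend: "periodic (zero_extend a)"
  by (simp add: periodic_def zero_extend_def)

text \<open>For even \<open>s\<close> the vector \<open>initial\<close> has even weight, so it lies
  in the image of the difference map, all of which the shuffles generate.\<close>

lemma shuffles_iso_twisted_shift:
  assumes "even s"
  shows "\<exists>\<phi>. cyclic_action q (Z2_power (q - 1)) (twisted_shift (q - 1)) \<phi> \<and>
    subgroup_generated (BijGroup {..<b ^ q}) {perm initial (int s), perm (\<lambda>_. False) (int s)} \<cong>
      semidirect_product (Z2_power (q - 1)) (integer_mod_group q) \<phi>"
proof (rule shuffles_iso_semidirect[where u = "\<lambda>a j. zero_extend a j \<noteq> zero_extend a (j + 1)"])
  let ?N = "Z2_power (q - 1)"
  have idx: "nat (j mod int q) \<in> {1..q - 1}" if "j mod int q \<noteq> 0" for j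
    using mod_q_bounds[of j] that by auto
  have bit: "a i = 0 \<or> a i = 1" if "a \<in> carrier ?N" "i \<in> {1..q - 1}" for a i
    using that PiE_mem[of a "{1..q - 1}" "\<lambda>_. {0..<2}" i] by (auto simp: carrier_integer_mod_group)
  show "group ?N" by simp
  show "(\<lambda>j. zero_extend a j \<noteq> zero_extend a (j + 1)) \<in> complements" for a
    by (rule boundary_in_complements[OF periodic_zero_extend])
  then show "periodic (\<lambda>j. zero_extend a j \<noteq> zero_extend a (j + 1))" for a
    by (rule complements_periodic)
  show "inj_on (\<lambda>a j. zero_extend a j \<noteq> zero_extend a (j + 1)) (carrier ?N)"
  proof (rule inj_onI)
    fix a c assume ac: "a \<in> carrier ?N" "c \<in> carrier ?N"
      and eq: "(\<lambda>j. zero_extend a j \<noteq> zero_extend a (j + 1)) =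
        (\<lambda>j. zero_extend c j \<noteq> zero_extend c (j + 1))"
    \<comment> \<open>Both vectors vanish at position 0, and equal differences propagate agreement
      from each position to the next.\<close>
    have ext: "zero_extend a (int i) = zero_extend c (int i)" for i
    proof (induction i)
      case 0
      then show ?case by (simp add: zero_extend_def)
    next
      case (Suc i)
      then show ?case using fun_cong[OF eq, of "int i"] by (auto simp: add.commute)
    qed
    show "a = c"
    proof (rule PiE_ext)
      fix i assume i: "i \<in> {1..q - 1}"
      then have "int i mod int q = int i" by (intro mod_pos_pos_trivial) auto
      then have "(a i = 1) = (c i = 1)"
        using ext[of i] i by (auto simp: zero_extend_def)
      then show "a i = c i" using bit[OF ac(1) i] bit[OF ac(2) i] by auto
    qed (use ac in auto)
  qed
  show "(zero_extend (a \<otimes>\<^bsub>?N\<^esub> c) j \<noteq> zero_extend (a \<otimes>\<^bsub>?N\<^esub> c) (j + 1)) =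
      ((zero_extend a j \<noteq> zero_extend a (j + 1)) \<noteq> (zero_extend c j \<noteq> zero_extend c (j + 1)))"
    if "a \<in> carrier ?N" "c \<in> carrier ?N" for a c j
  proof -
    have "zero_extend (a \<otimes>\<^bsub>?N\<^esub> c) i = (zero_extend a i \<noteq> zero_extend c i)" for i
    proof (cases "i mod int q = 0")
      case False
      then show ?thesis
        using bit[OF that(1) idx[OF False]] bit[OF that(2) idx[OF False]] idx[OF False]
        by (auto simp: zero_extend_def)
    qed (simp add: zero_extend_def)
    then show ?thesis by auto
  qed
  \<comment> \<open>The positions 1, 3, ..., \<open>s - 1\<close>: together with their predecessors
    they fill 0, ..., \<open>s - 1\<close>.\<close>
  let ?w = "\<lambda>i\<in>{1..q - 1}. of_bool (odd i \<and> i < s) :: int"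
  have w: "?w \<in> carrier ?N" by (auto simp: carrier_integer_mod_group)
  have w_initial: "initial = (\<lambda>j. zero_extend ?w j \<noteq> zero_extend ?w (j + 1))"
  proof
    fix j
    have bits: "zero_extend ?w i = (odd (i mod int q) \<and> i mod int q < int s)" for i
      using idx[of i] mod_q_bounds[of i]
      by (cases "i mod int q = 0") (auto simp: zero_extend_def even_nat_iff nat_less_iff)
    \<comment> \<open>As \<open>s\<close> is even, an odd successor of a position below
      \<open>s\<close> cannot be \<open>s\<close> itself.\<close>
    have "x < int s" if "x - 1 < int s" "odd x" for x
      using that assms by (cases "x = int s") auto
    from this[of "(j + 1) mod int q"]
    show "initial j = (zero_extend ?w j \<noteq> zero_extend ?w (j + 1))"
      unfolding bits initial_def
      using mod_pred[of "j + 1"] mod_q_bounds[of "j + 1"] s_less assms by (auto split: if_splits)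
  qed
  show "initial \<in> (\<lambda>a j. zero_extend a j \<noteq> zero_extend a (j + 1)) ` carrier ?N"
    by (rule image_eqI[where x = ?w]) (rule w_initial, rule w)
  show "twisted_shift (q - 1) \<in> extensional (carrier ?N)" by (simp add: twisted_shift_def)
  show "twisted_shift (q - 1) a \<in> carrier ?N" if "a \<in> carrier ?N" for a
    using that len by (auto simp: twisted_shift_def Pi_iff PiE_iff carrier_integer_mod_group)
  show "(zero_extend (twisted_shift (q - 1) a) j \<noteq> zero_extend (twisted_shift (q - 1) a) (j + 1)) =
      (zero_extend a (j - 1) \<noteq> zero_extend a (j - 1 + 1))"
    if "a \<in> carrier ?N" for a j
  proof -
    \<comment> \<open>The twisted shift is the cyclic shift plus the constant that resets position 0
      to zero; the constant cancels in the differences.\<close>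
    have twist: "zero_extend (twisted_shift (q - 1) a) i = (zero_extend a (i - 1) \<noteq> zero_extend a (- 1))" for i
    proof -
      have last: "zero_extend a (- 1) = (a (q - 1) = 1)"
        using len by (simp add: zero_extend_def zmod_minus1 nat_diff_distrib)
      consider "i mod int q = 0" | "i mod int q = 1" | "1 < i mod int q"
        using mod_q_bounds[of i] by linarith
      then show ?thesis
      proof cases
        case 1
        then show ?thesis
          unfolding last using len by (simp add: zero_extend_def mod_pred nat_diff_distrib)
      next
        case 2
        then show ?thesis
          unfolding last using len that
          by (simp add: zero_extend_def mod_pred twisted_shift_def)
      next
        case 3
        define n where "n = nat (i mod int q)"
        have n: "i mod int q = int n" "1 < n" "n \<le> q - 1"
          using 3 mod_q_bounds[of i] by (auto simp: n_def)
        have pred: "(i - 1) mod int q = int (n - 1)" using n by (simp add: mod_pred of_nat_diff)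
        have "twisted_shift (q - 1) a n = (a (n - 1) + a (q - 1)) mod 2"
          using n that by (simp add: twisted_shift_def)
        moreover have "a (n - 1) = 0 \<or> a (n - 1) = 1" "a (q - 1) = 0 \<or> a (q - 1) = 1"
          using n by (auto intro!: bit[OF that])
        moreover have "zero_extend a (i - 1) = (a (n - 1) = 1)"
          using n by (simp only: zero_extend_def pred nat_int) simp
        moreover have "zero_extend (twisted_shift (q - 1) a) i = (twisted_shift (q - 1) a n = 1)"
          using n by (simp only: zero_extend_def n(1) nat_int) simp
        ultimately show ?thesis unfolding last by auto
      qed
    qed
    show ?thesis unfolding twist by auto
  qed
qed

end

section \<open>Passage to base \<open>m ^ c\<close>\<close>

theorem theorem2:
  fixes m k y c :: nat and G :: "(nat \<Rightarrow> nat) monoid"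
  assumes "m > 1" and "k > 1" and "0 < y" and "y < k"
    and "c = gcd y k"
    and "G = subgroup_generated (BijGroup {..<m ^ k})
               {in_shuffle (m ^ y) (m ^ (k - y)), out_shuffle (m ^ y) (m ^ (k - y))}"
  shows
    "(odd (y div c) \<longrightarrow>
       (\<exists>\<phi>. cyclic_action (k div c) (Z2_power (k div c)) (cyclic_shift (k div c)) \<phi> \<and>
            G \<cong> semidirect_product (Z2_power (k div c)) (integer_mod_group (k div c)) \<phi>)) \<and>
     (even (y div c) \<longrightarrow>
       (\<exists>\<phi>. cyclic_action (k div c) (Z2_power (k div c - 1)) (twisted_shift (k div c - 1)) \<phi> \<and>
            G \<cong> semidirect_product (Z2_power (k div c - 1)) (integer_mod_group (k div c)) \<phi>))"
proof -
  \<comment> \<open>In base \<open>m ^ c\<close> the exponents \<open>y\<close> and \<open>k\<close>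
    become the coprime numbers \<open>s\<close> and \<open>q\<close>, while the deck and the stacks
    stay the same.\<close>
  define b s q where "b = m ^ c" and "s = y div c" and "q = k div c"
  have c: "0 < c" "c dvd y" "c dvd k" using assms by auto
  then have ys: "y = c * s" and kq: "k = c * q" by (simp_all add: s_def q_def)
  have "0 < s" "s < q" using assms(3,4) ys kq by auto
  moreover have "coprime s q"
    unfolding s_def q_def assms(5) using assms(3) by (intro div_gcd_coprime) auto
  moreover have "1 < b" using assms(1) c(1) by (simp only: b_def one_less_power)
  ultimately interpret shuffle_pair b q s by unfold_locales auto
  have "m ^ y = b ^ s" "m ^ k = b ^ q" "m ^ (k - y) = b ^ (q - s)"
    by (simp_all add: b_def ys kq flip: power_mult diff_mult_distrib2)
  then have "G = subgroup_generated (BijGroup {..<b ^ q})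
      {perm initial (int s), perm (\<lambda>_. False) (int s)}"
    using s_less by (simp add: assms(6) in_shuffle_eq_perm out_shuffle_eq_perm initial_def)
  then show ?thesis using shuffles_iso_cyclic_shift shuffles_iso_twisted_shift by (simp add: s_def q_def)
qed

end
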